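(* Let $P$ be a polygon (prototile) that tiles some flat torus. Then every tiling of a flat torus by congruent copies of $P$ covers a minimal torus tiling. Moreover, the set of (isometry classes up to scaling of) flat tori that admit a tiling by congruent copies of $P$ is dense in the moduli space $\mathbb{H}^2/SL_2(\mathbb{Z})$ of flat tori.
   Context: A flat torus is $\mathbb{C}/\Lambda$ for a lattice $\Lambda=\mathbb{Z}\alpha+\mathbb{Z}\beta$, $\alpha,\beta$ a real basis of $\mathbb{C}$, with the metric induced from $\mathbb{C}$; tori $\mathbb{C}/\Lambda$ and $\mathbb{C}/c\Lambda$ ($c\neq 0$ complex) are regarded as isometric (isometry up to scaling). Every flat torus is isometric to $T_\tau=\mathbb{C}/(\mathbb{Z}+\mathbb{Z}\tau)$ with $\tau$ in the upper half plane $\mathbb{H}^2$, and $T_\tau\cong T_{\tau'}$ iff $\tau'=\frac{c+d\tau}{a+b\tau}$ for some $\begin{pmatrix}a&b\\c&d\end{pmatrix}\in SL_2(\mathbb{Z})$; so the moduli space of flat tori is $\mathbb{H}^2/SL_2(\mathbb{Z})$. A tiling of $\mathbb{C}/\Lambda$ lifts to a $\Lambda$-invariant tiling of $\mathbb{C}$; if $\Lambda'\subset\Lambda$ is a sublattice, the induced tiling of $\mathbb{C}/\Lambda'$ by the same plane tiling is said to cover the tiling of $\mathbb{C}/\Lambda$. A torus tiling $\mathcal{T}$ is minimal if whenever $\mathcal{T}$ covers a torus tiling $\mathcal{T}'$, then $\mathcal{T}=\mathcal{T}'$. *)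

theory Defs
  imports "HOL-Analysis.Analysis"
begin

subsection \<open>Polygons and congruence\<close>

fun polygonal_path :: "complex list \<Rightarrow> real \<Rightarrow> complex" where
  "polygonal_path [] = linepath 0 0"
| "polygonal_path [a] = linepath a a"
| "polygonal_path [a, b] = linepath a b"
| "polygonal_path (a # b # c # vs) = linepath a b +++ polygonal_path (b # c # vs)"

text \<open>A polygon is the closed region bounded by a simple closed polygonal curve; it need not be convex.\<close>

definition polygon :: "complex set \<Rightarrow> bool" where
  "polygon P \<longleftrightarrow> (\<exists>vs. 3 \<le> length vs \<and> simple_path (polygonal_path (vs @ [hd vs])) \<and>
     P = path_image (polygonal_path (vs @ [hd vs])) \<union>
         inside (path_image (polygonal_path (vs @ [hd vs]))))"

text \<open>Orientation-reversing isometries are allowed.\<close>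

definition congruent_to :: "complex set \<Rightarrow> complex set \<Rightarrow> bool" where
  "congruent_to P Q \<longleftrightarrow> (\<exists>f. (\<forall>x y. dist (f x) (f y) = dist x y) \<and> Q = f ` P)"


subsection \<open>Lattices and torus tilings\<close>

definition int_span2 :: "complex \<Rightarrow> complex \<Rightarrow> complex set" where
  "int_span2 \<alpha> \<beta> = {of_int m * \<alpha> + of_int n * \<beta> | m n. True}"

definition is_lattice :: "complex set \<Rightarrow> bool" where
  "is_lattice \<Lambda> \<longleftrightarrow> (\<exists>\<alpha> \<beta>. independent {\<alpha>, \<beta>} \<and> span {\<alpha>, \<beta>} = UNIV \<and> \<Lambda> = int_span2 \<alpha> \<beta>)"

text \<open>Tilings are not required to be edge-to-edge.\<close>

definition plane_tiling :: "complex set set \<Rightarrow> bool" where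
  "plane_tiling \<T> \<longleftrightarrow>
     (\<forall>t\<in>\<T>. polygon t) \<and>
     \<Union>\<T> = UNIV \<and>
     pairwise (\<lambda>s t. interior s \<inter> interior t = {}) \<T> \<and>
     (\<forall>z. \<exists>r>0. finite {t \<in> \<T>. t \<inter> ball z r \<noteq> {}})"

text \<open>
  A flat torus \<open>\<complex>/\<Lambda>\<close> is given by its lattice \<open>\<Lambda>\<close>, and a tiling of it by the pair of \<open>\<Lambda>\<close> and the
  lifted, \<open>\<Lambda>\<close>-invariant tiling of the plane.  Recording the images of the tiles in \<open>\<complex>/\<Lambda>\<close> as mere
  point sets would lose information: in a tiling with one tile, that image is the whole torus.
\<close>

type_synonym tiled_torus = "complex set \<times> complex set set"

definition torus_tiling :: "tiled_torus \<Rightarrow> bool" where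
  "torus_tiling X \<longleftrightarrow> is_lattice (fst X) \<and> plane_tiling (snd X) \<and>
     (\<forall>l\<in>fst X. \<forall>t\<in>snd X. (+) l ` t \<in> snd X)"

definition torus_tiling_by :: "complex set \<Rightarrow> tiled_torus \<Rightarrow> bool" where
  "torus_tiling_by P X \<longleftrightarrow> torus_tiling X \<and> (\<forall>t\<in>snd X. congruent_to P t)"

definition tiling_covers :: "tiled_torus \<Rightarrow> tiled_torus \<Rightarrow> bool" where
  "tiling_covers X Y \<longleftrightarrow> fst X \<subseteq> fst Y \<and> snd X = snd Y"

definition minimal_torus_tiling :: "tiled_torus \<Rightarrow> bool" where
  "minimal_torus_tiling X \<longleftrightarrow> torus_tiling X \<and>
     (\<forall>Y. torus_tiling Y \<and> tiling_covers X Y \<longrightarrow> X = Y)"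


subsection \<open>The moduli space of flat tori\<close>

definition upper_half_plane :: "complex set" where
  "upper_half_plane = {\<tau>. Im \<tau> > 0}"

definition modular_rel :: "(complex \<times> complex) set" where
  "modular_rel = {(\<tau>, \<tau>'). \<tau> \<in> upper_half_plane \<and> \<tau>' \<in> upper_half_plane \<and>
     (\<exists>a b c d :: int. a * d - b * c = 1 \<and>
        \<tau>' = (of_int c + of_int d * \<tau>) / (of_int a + of_int b * \<tau>))}"

definition moduli_space :: "complex set topology" where
  "moduli_space = topology (\<lambda>U. U \<subseteq> upper_half_plane // modular_rel \<and>
     openin (top_of_set upper_half_plane) {\<tau> \<in> upper_half_plane. modular_rel `` {\<tau>} \<in> U})"

lemma openin_moduli_space:
  "openin moduli_space U \<longleftrightarrow> U \<subseteq> upper_half_plane // modular_rel \<and>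
     openin (top_of_set upper_half_plane) {\<tau> \<in> upper_half_plane. modular_rel `` {\<tau>} \<in> U}"
proof -
  let ?f = "\<lambda>U. {\<tau> \<in> upper_half_plane. modular_rel `` {\<tau>} \<in> U}"
  have "istopology (\<lambda>U. U \<subseteq> upper_half_plane // modular_rel \<and>
          openin (top_of_set upper_half_plane) (?f U))"
    unfolding istopology_def
  proof (intro conjI allI impI; (elim conjE)?)
    fix S T
    assume "openin (top_of_set upper_half_plane) (?f S)"
      and "openin (top_of_set upper_half_plane) (?f T)"
    moreover have "?f (S \<inter> T) = ?f S \<inter> ?f T" by auto
    ultimately show "openin (top_of_set upper_half_plane) (?f (S \<inter> T))"
      by (simp only: openin_Int)
  next
    fix K
    assume "\<forall>S\<in>K. S \<subseteq> upper_half_plane // modular_rel \<and>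
              openin (top_of_set upper_half_plane) (?f S)"
    moreover have "?f (\<Union>K) = \<Union>(?f ` K)" by auto
    ultimately show "openin (top_of_set upper_half_plane) (?f (\<Union>K))"
      by (simp only:) (rule openin_Union, blast)
  qed auto
  then show ?thesis
    by (simp add: moduli_space_def topology_inverse')
qed

lemma topspace_moduli_space: "topspace moduli_space = upper_half_plane // modular_rel"
proof
  show "topspace moduli_space \<subseteq> upper_half_plane // modular_rel"
    using openin_moduli_space openin_topspace by blast
  have "{\<tau> \<in> upper_half_plane. modular_rel `` {\<tau>} \<in> upper_half_plane // modular_rel} = upper_half_plane"
    by (auto intro: quotientI)
  then have "openin moduli_space (upper_half_plane // modular_rel)"
    by (simp add: openin_moduli_space)
  then show "upper_half_plane // modular_rel \<subseteq> topspace moduli_space"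
    by (rule openin_subset)
qed

lemma quotient_map_moduli_space:
  "quotient_map (top_of_set upper_half_plane) moduli_space (\<lambda>\<tau>. modular_rel `` {\<tau>})"
proof -
  have "(\<lambda>\<tau>. modular_rel `` {\<tau>}) ` upper_half_plane = upper_half_plane // modular_rel"
    by (auto simp: quotient_def)
  then show ?thesis
    by (simp add: quotient_map_def topspace_moduli_space openin_moduli_space)
qed

definition tileable_tori :: "complex set \<Rightarrow> complex set set" where
  "tileable_tori P = {modular_rel `` {\<tau>} | \<tau>. \<tau> \<in> upper_half_plane \<and>
     (\<exists>c \<T>. c \<noteq> 0 \<and> torus_tiling_by P ((*) c ` int_span2 1 \<tau>, \<T>))}"

end

theory Submission
  imports Defs
begin

text \<open>
  A nonzero translation moves a bounded tile off itself, so by local finiteness only finitely many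
  translations from a bounded fundamental domain of \<open>\<Lambda>\<close> map a given tile to a tile.  Hence only
  finitely many lattices containing \<open>\<Lambda>\<close> preserve the tiling, and a maximal one gives the minimal
  tiling that is covered.  For density, every sublattice of \<open>\<int>\<alpha> + \<int>\<beta>\<close> carries the same plane
  tiling; the sublattices \<open>N\<alpha>\<int> + (r\<alpha> + s\<beta>)\<int>\<close> have moduli \<open>r/N + (s/N) \<beta>/\<alpha>\<close>, and these are
  already dense in the upper half plane.
\<close>

section \<open>Finitely many translations carry a tile to a tile\<close>

lemma polygon_bounded: "polygon P \<Longrightarrow> bounded P"
  unfolding polygon_def
  by (auto simp: bounded_inside bounded_simple_path_image)

lemma polygon_nonempty: "polygon P \<Longrightarrow> P \<noteq> {}"
  unfolding polygon_def by auto

text \<open>Iterating the translation keeps the orbit of a point inside \<open>S\<close>, and for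
  nonzero \<open>d\<close> this orbit is unbounded.\<close>

lemma translation_of_bounded_set_eq:
  fixes S :: "complex set"
  assumes "bounded S" "S \<noteq> {}" "(+) d ` S = S"
  shows "d = 0"
proof (rule ccontr)
  assume "d \<noteq> 0"
  obtain x where "x \<in> S" using assms(2) by blast
  have step: "x + of_nat n * d \<in> S" for n
  proof (induction n)
    case (Suc n)
    then have "d + (x + of_nat n * d) \<in> S" using assms(3) by blast
    then show ?case by (simp add: algebra_simps)
  qed (use \<open>x \<in> S\<close> in simp)
  obtain B where B: "\<And>y. y \<in> S \<Longrightarrow> norm y \<le> B"
    using assms(1) unfolding bounded_iff by blast
  obtain n where n: "B + norm x < real n * norm d"
    using reals_Archimedean3[of "norm d"] \<open>d \<noteq> 0\<close> by auto
  have "real n * norm d = norm ((x + of_nat n * d) - x)" by (simp add: norm_mult)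
  also have "\<dots> \<le> norm (x + of_nat n * d) + norm x" by (rule norm_triangle_ineq4)
  also have "\<dots> \<le> B + norm x" using B[OF step] by simp
  finally show False using n by simp
qed

text \<open>This allows translation vectors to be counted by counting the tiles that they
  produce.\<close>

lemma inj_translates_of_bounded_set:
  fixes S :: "complex set"
  assumes "bounded S" "S \<noteq> {}"
  shows "inj (\<lambda>l. (+) l ` S)"
proof (rule injI)
  fix l m assume eq: "(+) l ` S = (+) m ` S"
  have "(+) (l - m) ` S = (+) (- m) ` (+) l ` S"
    by (simp add: image_image algebra_simps)
  also have "\<dots> = S" by (simp add: eq image_image)
  finally show "l = m" using translation_of_bounded_set_eq[OF assms] by fastforce
qed

lemma plane_tiling_finite_meeting_compact:
  assumes "plane_tiling \<T>" "compact K"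
  shows "finite {t \<in> \<T>. t \<inter> K \<noteq> {}}"
proof -
  have "\<forall>z. \<exists>r>0. finite {t \<in> \<T>. t \<inter> ball z r \<noteq> {}}"
    using assms(1) by (simp add: plane_tiling_def)
  from choice[OF this] obtain r
    where r: "\<And>z. r z > 0" "\<And>z. finite {t \<in> \<T>. t \<inter> ball z (r z) \<noteq> {}}"
    by blast
  have "K \<subseteq> (\<Union>z\<in>K. ball z (r z))" using r(1) by force
  then obtain C where C: "finite C" "K \<subseteq> (\<Union>z\<in>C. ball z (r z))"
    using compactE_image[OF assms(2), of K "\<lambda>z. ball z (r z)"] open_ball by metis
  have "{t \<in> \<T>. t \<inter> K \<noteq> {}} \<subseteq> (\<Union>z\<in>C. {t \<in> \<T>. t \<inter> ball z (r z) \<noteq> {}})"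
    using C(2) by blast
  then show ?thesis by (rule finite_subset) (simp add: C(1) r(2))
qed

text \<open>If \<open>z\<close> lies in \<open>t\<close> and \<open>B\<close> has norms at most
  \<open>R\<close>, every translate of \<open>t\<close> by a vector of \<open>B\<close> contains a
  point of the closed ball of radius \<open>R\<close> around \<open>z\<close>. By compactness only
  finitely many tiles meet that ball.\<close>

lemma finite_tile_translations:
  assumes "plane_tiling \<T>" "t \<in> \<T>" "bounded B"
  shows "finite {l \<in> B. (+) l ` t \<in> \<T>}"
proof -
  have t: "bounded t" "t \<noteq> {}"
    using assms polygon_bounded polygon_nonempty unfolding plane_tiling_def by blast+
  then obtain z where z: "z \<in> t" by blast
  obtain R where R: "\<And>l. l \<in> B \<Longrightarrow> norm l \<le> R" using assms(3) unfolding bounded_iff by blast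
  have "(\<lambda>l. (+) l ` t) ` {l \<in> B. (+) l ` t \<in> \<T>} \<subseteq> {s \<in> \<T>. s \<inter> cball z R \<noteq> {}}"
  proof clarsimp
    fix l assume "l \<in> B" and e: "(+) l ` t \<inter> cball z R = {}"
    then have "l + z \<in> (+) l ` t \<inter> cball z R" using z R by (auto simp: dist_norm)
    then show False using e by blast
  qed
  then have "finite ((\<lambda>l. (+) l ` t) ` {l \<in> B. (+) l ` t \<in> \<T>})"
    using plane_tiling_finite_meeting_compact[OF assms(1) compact_cball] by (rule finite_subset)
  then show ?thesis
    by (rule finite_imageD) (rule inj_on_subset[OF inj_translates_of_bounded_set[OF t] subset_UNIV])
qed

section \<open>Real bases of the plane and lattices\<close>

lemma complex_coordinates:
  assumes "Im \<omega> \<noteq> 0"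
  obtains x y where "z = complex_of_real x + of_real y * \<omega>"
proof
  show "z = of_real (Re z - Im z / Im \<omega> * Re \<omega>) + of_real (Im z / Im \<omega>) * \<omega>"
    using assms by (simp add: complex_eq_iff)
qed

text \<open>Division by \<alpha> turns the pair into 1 and \<beta>/\<alpha>, a real basis exactly
  when \<beta>/\<alpha> is not real. If \<alpha> = \<beta>, the set is a singleton and may be
  independent; it is the span condition that excludes this case.\<close>

lemma real_basis_complex_iff:
  fixes \<alpha> \<beta> :: complex
  shows "independent {\<alpha>, \<beta>} \<and> span {\<alpha>, \<beta>} = UNIV \<longleftrightarrow> \<alpha> \<noteq> 0 \<and> Im (\<beta> / \<alpha>) \<noteq> 0"
proof (intro iffI conjI; elim conjE)
  assume "independent {\<alpha>, \<beta>}"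
  then show a: "\<alpha> \<noteq> 0" using dependent_zero by blast
  assume sp: "span {\<alpha>, \<beta>} = UNIV"
  \<comment> \<open>Expanding this vector in the basis and comparing imaginary parts after division
    by \<alpha> gives 1 = \<open>j * Im (\<beta> / \<alpha>)\<close>.\<close>
  have "\<i> * \<alpha> \<in> span {\<alpha>, \<beta>}" using sp by blast
  then obtain k j where "\<i> * \<alpha> - k *\<^sub>R \<alpha> - j *\<^sub>R \<beta> = 0"
    by (auto simp: span_insert)
  then have "\<i> = of_real k + of_real j * (\<beta> / \<alpha>)"
    using a by (simp add: field_simps scaleR_conv_of_real)
  then have "Im \<i> = Im (of_real k + of_real j * (\<beta> / \<alpha>))" by (rule arg_cong)
  also have "\<dots> = j * Im (\<beta> / \<alpha>)"
    unfolding plus_complex.sel Im_complex_of_real times_complex.sel Re_complex_of_real by simp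
  finally show "Im (\<beta> / \<alpha>) \<noteq> 0" by auto
next
  assume a: "\<alpha> \<noteq> 0" and im: "Im (\<beta> / \<alpha>) \<noteq> 0"
  have "\<beta> \<notin> span {\<alpha>}"
  proof
    assume "\<beta> \<in> span {\<alpha>}"
    then obtain k where "\<beta> = k *\<^sub>R \<alpha>" by (auto simp: span_singleton)
    then show False using im a by (simp add: scaleR_conv_of_real)
  qed
  then have "independent {\<beta>, \<alpha>}" using a by (simp add: independent_insert)
  then show "independent {\<alpha>, \<beta>}" by (simp add: insert_commute)
next
  assume a: "\<alpha> \<noteq> 0" and im: "Im (\<beta> / \<alpha>) \<noteq> 0"
  have "z \<in> span {\<alpha>, \<beta>}" for z
  proof -
    obtain x y where "z / \<alpha> = complex_of_real x + of_real y * (\<beta> / \<alpha>)"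
      using complex_coordinates[OF im] by blast
    then have "z = x *\<^sub>R \<alpha> + y *\<^sub>R \<beta>" using a by (simp add: field_simps scaleR_conv_of_real)
    then show ?thesis by (simp add: span_add span_base span_scale)
  qed
  then show "span {\<alpha>, \<beta>} = UNIV" by blast
qed

lemma is_lattice_iff:
  "is_lattice \<Lambda> \<longleftrightarrow> (\<exists>\<alpha> \<beta>. \<alpha> \<noteq> 0 \<and> Im (\<beta> / \<alpha>) \<noteq> 0 \<and> \<Lambda> = int_span2 \<alpha> \<beta>)"
  unfolding is_lattice_def using real_basis_complex_iff by blast

lemma int_span2_add:
  assumes "x \<in> int_span2 \<alpha> \<beta>" "y \<in> int_span2 \<alpha> \<beta>"
  shows "x + y \<in> int_span2 \<alpha> \<beta>"
proof -
  from assms obtain m n k l where "x = of_int m * \<alpha> + of_int n * \<beta>" "y = of_int k * \<alpha> + of_int l * \<beta>"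
    unfolding int_span2_def by blast
  then have "x + y = of_int (m + k) * \<alpha> + of_int (n + l) * \<beta>" by (simp add: algebra_simps)
  then show ?thesis unfolding int_span2_def by blast
qed

lemma int_span2_uminus:
  assumes "x \<in> int_span2 \<alpha> \<beta>"
  shows "- x \<in> int_span2 \<alpha> \<beta>"
proof -
  from assms obtain m n where "x = of_int m * \<alpha> + of_int n * \<beta>"
    unfolding int_span2_def by blast
  then have "- x = of_int (- m) * \<alpha> + of_int (- n) * \<beta>" by (simp add: algebra_simps)
  then show ?thesis unfolding int_span2_def by blast
qed

lemma lattice_add: "is_lattice \<Lambda> \<Longrightarrow> x \<in> \<Lambda> \<Longrightarrow> y \<in> \<Lambda> \<Longrightarrow> x + y \<in> \<Lambda>"
  unfolding is_lattice_def using int_span2_add by blast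

lemma lattice_uminus: "is_lattice \<Lambda> \<Longrightarrow> x \<in> \<Lambda> \<Longrightarrow> - x \<in> \<Lambda>"
  unfolding is_lattice_def using int_span2_uminus by blast

text \<open>Subtracting the integer parts of the coordinates leaves coordinates in [0,1). A closed
  ball serves as \<open>F\<close>: it has to meet every coset of \<Lambda>, but not only
  once.\<close>

lemma lattice_cobounded:
  assumes "is_lattice \<Lambda>"
  obtains F where "bounded F" "\<And>z. \<exists>l\<in>\<Lambda>. z + l \<in> F"
proof -
  obtain \<alpha> \<beta> where a: "\<alpha> \<noteq> 0" and im: "Im (\<beta> / \<alpha>) \<noteq> 0" and L: "\<Lambda> = int_span2 \<alpha> \<beta>"
    using assms is_lattice_iff by blast
  have "\<exists>l\<in>\<Lambda>. z + l \<in> cball 0 (norm \<alpha> + norm \<beta>)" for z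
  proof -
    obtain x y where "z / \<alpha> = complex_of_real x + of_real y * (\<beta> / \<alpha>)"
      using complex_coordinates[OF im] by blast
    then have z: "z = of_real x * \<alpha> + of_real y * \<beta>" using a by (simp add: field_simps)
    let ?l = "of_int (- \<lfloor>x\<rfloor>) * \<alpha> + of_int (- \<lfloor>y\<rfloor>) * \<beta>"
    have l: "?l \<in> \<Lambda>" unfolding L int_span2_def by blast
    have "z + ?l = of_real (frac x) * \<alpha> + of_real (frac y) * \<beta>"
      by (simp add: z frac_def algebra_simps)
    also have "norm \<dots> \<le> frac x * norm \<alpha> + frac y * norm \<beta>"
      by (rule norm_triangle_le) (simp add: norm_mult)
    also have "\<dots> \<le> 1 * norm \<alpha> + 1 * norm \<beta>"
      by (intro add_mono mult_right_mono) (simp_all add: frac_lt_1 less_imp_le)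
    finally have "z + ?l \<in> cball 0 (norm \<alpha> + norm \<beta>)" by simp
    then show ?thesis using l by blast
  qed
  then show ?thesis using that bounded_cball by blast
qed

section \<open>Minimal tilings from maximal lattices\<close>

lemma finite_lattices_preserving_tiling:
  assumes "plane_tiling \<T>" "is_lattice \<Lambda>"
  shows "finite {M. \<Lambda> \<subseteq> M \<and> torus_tiling (M, \<T>)}" (is "finite ?S")
proof -
  obtain t where t: "t \<in> \<T>" using assms(1) unfolding plane_tiling_def by blast
  obtain F where F: "bounded F" "\<And>z. \<exists>l\<in>\<Lambda>. z + l \<in> F" using lattice_cobounded[OF assms(2)] by blast
  \<comment> \<open>Every vector of an admissible \<open>M\<close> carries \<open>t\<close> to a
    tile, so the trace of \<open>M\<close> on \<open>F\<close> lies in one fixed finite set.\<close>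
  have "(\<lambda>M. M \<inter> F) ` ?S \<subseteq> Pow {l \<in> F. (+) l ` t \<in> \<T>}"
    using t by (auto simp: torus_tiling_def)
  then have "finite ((\<lambda>M. M \<inter> F) ` ?S)"
    using finite_tile_translations[OF assms(1) t F(1)] by (meson finite_Pow_iff finite_subset)
  moreover have "inj_on (\<lambda>M. M \<inter> F) ?S"
  proof -
    \<comment> \<open>A lattice containing \<Lambda> is a union of cosets of \<Lambda>, each of
      which meets \<open>F\<close>; hence its trace on \<open>F\<close> determines it.\<close>
    have sub: "M \<subseteq> N" if M: "M \<in> ?S" and N: "N \<in> ?S" and eq: "M \<inter> F = N \<inter> F" for M N
    proof
      fix z assume z: "z \<in> M"
      obtain l where l: "l \<in> \<Lambda>" "z + l \<in> F" using F(2) by blast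
      have lat: "is_lattice M" "is_lattice N" "\<Lambda> \<subseteq> M" "\<Lambda> \<subseteq> N"
        using M N by (auto simp: torus_tiling_def)
      have "z + l \<in> N" using lattice_add[OF lat(1) z] l lat(3) eq by blast
      then have "(z + l) + (- l) \<in> N"
        using lattice_add[OF lat(2)] lattice_uminus[OF lat(2)] l(1) lat(4) by blast
      then show "z \<in> N" by simp
    qed
    show ?thesis
    proof (rule inj_onI)
      fix M N assume "M \<in> ?S" "N \<in> ?S" "M \<inter> F = N \<inter> F"
      then show "M = N" using sub[of M N] sub[of N M] by simp
    qed
  qed
  ultimately show ?thesis by (rule finite_imageD)
qed

lemma torus_tiling_covers_minimal:
  assumes "torus_tiling X"
  obtains Y where "minimal_torus_tiling Y" "tiling_covers X Y"
proof -
  obtain \<Lambda> \<T> where X: "X = (\<Lambda>, \<T>)" by fastforce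
  let ?S = "{M. \<Lambda> \<subseteq> M \<and> torus_tiling (M, \<T>)}"
  have "finite ?S"
    using finite_lattices_preserving_tiling assms unfolding X torus_tiling_def by simp
  moreover have "?S \<noteq> {}" using assms X by blast
  ultimately obtain M where M: "M \<in> ?S" "\<And>N. N \<in> ?S \<Longrightarrow> M \<subseteq> N \<Longrightarrow> M = N"
    using finite_has_maximal[of ?S] by blast
  have "minimal_torus_tiling (M, \<T>)"
    unfolding minimal_torus_tiling_def
  proof (intro conjI allI impI)
    show "torus_tiling (M, \<T>)" using M(1) by blast
    fix Y assume Y: "torus_tiling Y \<and> tiling_covers (M, \<T>) Y"
    then have "snd Y = \<T>" "M \<subseteq> fst Y" by (auto simp: tiling_covers_def)
    \<comment> \<open>The lattice of \<open>Y\<close> contains \<open>M\<close>, hence \<Lambda>, so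
      it belongs to the family in which \<open>M\<close> is maximal.\<close>
    moreover from this have "fst Y \<in> ?S" using Y M(1) by auto
    ultimately show "(M, \<T>) = Y" using M(2) by (metis prod.collapse)
  qed
  moreover have "tiling_covers X (M, \<T>)" using M(1) X by (simp add: tiling_covers_def)
  ultimately show ?thesis using that by blast
qed

section \<open>Sublattices and density in the moduli space\<close>

lemma torus_tiling_by_sublattice:
  assumes "torus_tiling_by P (\<Lambda>, \<T>)" "is_lattice M" "M \<subseteq> \<Lambda>"
  shows "torus_tiling_by P (M, \<T>)"
  using assms unfolding torus_tiling_by_def torus_tiling_def by auto

lemma mult_image_int_span2: "(*) c ` int_span2 \<alpha> \<beta> = int_span2 (c * \<alpha>) (c * \<beta>)"
proof -
  have "c * (of_int m * \<alpha> + of_int n * \<beta>) = of_int m * (c * \<alpha>) + of_int n * (c * \<beta>)" for m n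
    by (simp add: algebra_simps)
  then show ?thesis unfolding int_span2_def by (force simp: image_iff)
qed

text \<open>The coordinate map is continuous, so the preimage of \<open>U\<close> contains an open
  box, and each side of the box contains a rational.\<close>

lemma rational_combinations_dense:
  assumes "Im \<omega> \<noteq> 0" "open U" "U \<noteq> {}"
  obtains x y where "x \<in> \<rat>" "y \<in> \<rat>" "complex_of_real x + of_real y * \<omega> \<in> U"
proof -
  let ?f = "\<lambda>p :: real \<times> real. complex_of_real (fst p) + of_real (snd p) * \<omega>"
  have "open (?f -` U)"
    by (rule open_vimage[OF assms(2)]) (intro continuous_intros)
  moreover obtain x y where "(x, y) \<in> ?f -` U"
  proof -
    obtain z where "z \<in> U" using assms(3) by blast
    moreover obtain x y where "z = complex_of_real x + of_real y * \<omega>"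
      using complex_coordinates[OF assms(1)] by blast
    ultimately show ?thesis using that by simp
  qed
  ultimately obtain A B where AB: "open A" "open B" "(x, y) \<in> A \<times> B" "A \<times> B \<subseteq> ?f -` U"
    by (rule open_prod_elim)
  obtain p q where "p \<in> \<rat>" "p \<in> A" "q \<in> \<rat>" "q \<in> B"
  proof -
    have "\<exists>p\<in>\<rat>. p \<in> S" if "open S" "s \<in> S" for S and s :: real
    proof -
      obtain e where "e > 0" "ball s e \<subseteq> S" using \<open>open S\<close> \<open>s \<in> S\<close> open_contains_ball by blast
      moreover obtain p where "p \<in> \<rat>" "s < p" "p < s + e"
        using Rats_dense_in_real[of s "s + e"] \<open>e > 0\<close> by auto
      ultimately show ?thesis by (force simp: dist_real_def)
    qed
    then show ?thesis using AB that by (meson mem_Sigma_iff)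
  qed
  then show ?thesis using that AB(4) by fastforce
qed

text \<open>A single denominator is needed because \<open>N\<close> becomes the scaling factor of
  the whole sublattice. Its sign is left free.\<close>

lemma Rats_common_denominator:
  fixes x y :: real
  assumes "x \<in> \<rat>" "y \<in> \<rat>"
  obtains N r s :: int where "N \<noteq> 0" "x = of_int r / of_int N" "y = of_int s / of_int N"
proof -
  obtain a b :: int where "b \<noteq> 0" "x = of_int a / of_int b"
    using assms(1) by (elim Rats_cases') (metis less_irrefl)
  moreover obtain c d :: int where "d \<noteq> 0" "y = of_int c / of_int d"
    using assms(2) by (elim Rats_cases') (metis less_irrefl)
  ultimately show ?thesis using that[of "b * d" "a * d" "c * b"] by (simp add: mult.commute)
qed

text \<open>Clearing denominators with \<open>c\<close> = N\<alpha> sends 1 and \<tau> to N\<alpha>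
  and r\<alpha> + s\<beta>, both in the given lattice. The basis \<alpha>, \<beta> may have either
  orientation, since only \<tau> has to lie in the upper half plane.\<close>

lemma tileable_moduli_rational_combination:
  assumes tiling: "torus_tiling_by P (int_span2 \<alpha> \<beta>, \<T>)" and "\<alpha> \<noteq> 0"
    and "x \<in> \<rat>" "y \<in> \<rat>" and \<tau>: "\<tau> = of_real x + of_real y * (\<beta> / \<alpha>)" "\<tau> \<in> upper_half_plane"
  shows "modular_rel `` {\<tau>} \<in> tileable_tori P"
proof -
  obtain N r s :: int where N: "N \<noteq> 0" "x = of_int r / of_int N" "y = of_int s / of_int N"
    using Rats_common_denominator[OF assms(3,4)] .
  define c where "c = of_int N * \<alpha>"
  have c: "c \<noteq> 0" using N(1) \<open>\<alpha> \<noteq> 0\<close> by (simp add: c_def)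
  have c\<tau>: "c * \<tau> = of_int r * \<alpha> + of_int s * \<beta>"
    using N(1) \<open>\<alpha> \<noteq> 0\<close> by (simp add: c_def \<tau>(1) N(2,3) field_simps)
  have img: "(*) c ` int_span2 1 \<tau> = int_span2 c (c * \<tau>)" by (simp add: mult_image_int_span2)
  \<comment> \<open>The quotient of the generators is \<tau>, which is not real.\<close>
  have "is_lattice (int_span2 c (c * \<tau>))"
    using c \<tau>(2) unfolding is_lattice_iff upper_half_plane_def
    by (intro exI[of _ c] exI[of _ "c * \<tau>"]) auto
  moreover have "int_span2 c (c * \<tau>) \<subseteq> int_span2 \<alpha> \<beta>"
  proof
    fix z assume "z \<in> int_span2 c (c * \<tau>)"
    then obtain m n where "z = of_int m * c + of_int n * (c * \<tau>)" unfolding int_span2_def by blast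
    then have "z = of_int (m * N + n * r) * \<alpha> + of_int (n * s) * \<beta>"
      unfolding c\<tau> by (simp add: c_def algebra_simps)
    then show "z \<in> int_span2 \<alpha> \<beta>" unfolding int_span2_def by blast
  qed
  ultimately have "torus_tiling_by P ((*) c ` int_span2 1 \<tau>, \<T>)"
    unfolding img by (rule torus_tiling_by_sublattice[OF tiling])
  then show ?thesis using c \<tau>(2) unfolding tileable_tori_def by blast
qed

lemma tileable_tori_dense:
  assumes "torus_tiling_by P X"
  shows "moduli_space closure_of tileable_tori P = topspace moduli_space"
proof (rule subset_antisym[OF closure_of_subset_topspace], rule subsetI)
  fix k assume k: "k \<in> topspace moduli_space"
  obtain \<Lambda> \<T> where X: "X = (\<Lambda>, \<T>)" by fastforce
  then obtain \<alpha> \<beta> where a: "\<alpha> \<noteq> 0" "Im (\<beta> / \<alpha>) \<noteq> 0" and L: "\<Lambda> = int_span2 \<alpha> \<beta>"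
    using assms is_lattice_iff unfolding torus_tiling_by_def torus_tiling_def by auto
  show "k \<in> moduli_space closure_of tileable_tori P"
    unfolding in_closure_of
  proof (intro conjI allI impI, fact k)
    fix U assume U: "k \<in> U \<and> openin moduli_space U"
    let ?V = "{\<tau> \<in> upper_half_plane. modular_rel `` {\<tau>} \<in> U}"
    have "open upper_half_plane"
      unfolding upper_half_plane_def by (rule open_halfspace_Im_gt)
    \<comment> \<open>The quotient topology gives openness relative to the half plane; as the half
      plane is open, \<open>?V\<close> is open in the whole plane, where the rational combinations
      are dense.\<close>
    then have "open ?V" using U by (simp add: openin_moduli_space openin_open_eq)
    moreover have "?V \<noteq> {}"
      using k U unfolding topspace_moduli_space by (auto elim!: quotientE)
    ultimately obtain x y where xy: "x \<in> \<rat>" "y \<in> \<rat>"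
      and V: "complex_of_real x + of_real y * (\<beta> / \<alpha>) \<in> ?V"
      using rational_combinations_dense[OF a(2)] by blast
    then show "\<exists>y. y \<in> tileable_tori P \<and> y \<in> U"
      using tileable_moduli_rational_combination[OF assms[unfolded X L] a(1) xy refl] by blast
  qed
qed

theorem theorem1p2:
  fixes P :: "complex set"
  assumes "polygon P"
    and "\<exists>X. torus_tiling_by P X"
  shows "(\<forall>X. torus_tiling_by P X \<longrightarrow> (\<exists>Y. minimal_torus_tiling Y \<and> tiling_covers X Y)) \<and>
    moduli_space closure_of tileable_tori P = topspace moduli_space"
proof (intro conjI allI impI)
  fix X assume "torus_tiling_by P X"
  then have "torus_tiling X" by (simp add: torus_tiling_by_def)
  then show "\<exists>Y. minimal_torus_tiling Y \<and> tiling_covers X Y"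
    by (rule torus_tiling_covers_minimal) blast
next
  \<comment> \<open>A single tiling suffices, since its sublattices alone give a dense set of
    classes.\<close>
  show "moduli_space closure_of tileable_tori P = topspace moduli_space"
    using assms(2) tileable_tori_dense by blast
qed

end
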